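(* Let $N\geq1$, $p>1$, $0<R\leq\infty$, and let $V\geq0$ and $W$ be smooth functions on $(0,R)$. Suppose that $(r^{N-1}V,r^{N-1}W)$ is a $p$-Bessel pair on $(0,R)$, that is, the ODE $$\left(r^{N-1}V(r)|y'|^{p-2}y'\right)'+r^{N-1}W(r)|y|^{p-2}y=0$$ has a positive solution $\varphi$ on $(0,R)$. Then for all $u\in C_0^\infty(B_R\setminus\{0\})$, $$\int_{B_R}V(|x|)|\nabla u|^p\,dx\geq\int_{B_R}V(|x|)\left|\frac{x}{|x|}\cdot\nabla u\right|^p dx\geq\int_{B_R}W(|x|)|u|^p\,dx$$ and $$\left(\int_{B_R}V(|x|)|\nabla u|^p dx\right)^{\frac1p}\left(\int_{B_R}\left|\frac{\varphi'}{\varphi}\right|^pV(|x|)|u|^p dx\right)^{\frac{p-1}{p}}$$ $$\geq\left(\int_{B_R}V(|x|)\left|\frac{x}{|x|}\cdot\nabla u\right|^p dx\right)^{\frac1p}\left(\int_{B_R}\left|\frac{\varphi'}{\varphi}\right|^pV(|x|)|u|^p dx\right)^{\frac{p-1}{p}}$$ $$\geq\frac1p\int_{B_R}\left[W(|x|)+(p-1)\left|\frac{\varphi'}{\varphi}\right|^pV(|x|)\right]|u|^p\,dx.$$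
   Context: $B_R=\{x\in\mathbb{R}^N:|x|<R\}$ (with $B_\infty=\mathbb{R}^N$). $C_0^\infty(B_R\setminus\{0\})$ is the space of real-valued smooth functions with compact support in $B_R\setminus\{0\}$. Inside the integrals, $\frac{\varphi'}{\varphi}$ means $\frac{\varphi'(|x|)}{\varphi(|x|)}$. Solutions of the ODE are understood in the classical sense. *)

theory Defs
  imports "HOL-Analysis.Analysis"
begin

(* The outer radius R ranges over (0, \<infinity>], hence over ereal. *)

definition radii :: "ereal \<Rightarrow> real set" where
  "radii R = {r. 0 < r \<and> ereal r < R}"

definition eball0 :: "ereal \<Rightarrow> 'a::euclidean_space set" where
  "eball0 R = {x. ereal (norm x) < R}"

(* Meant for open S: derivatives are taken at x in the whole space. *)

primrec Ck_on :: "nat \<Rightarrow> ('a::euclidean_space \<Rightarrow> real) \<Rightarrow> 'a set \<Rightarrow> bool" where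
  "Ck_on 0 f S \<longleftrightarrow> continuous_on S f"
| "Ck_on (Suc k) f S \<longleftrightarrow>
     (\<forall>x\<in>S. f differentiable (at x)) \<and>
     (\<forall>v. Ck_on k (\<lambda>x. frechet_derivative f (at x) v) S)"

definition smooth_on :: "('a::euclidean_space \<Rightarrow> real) \<Rightarrow> 'a set \<Rightarrow> bool" where
  "smooth_on f S \<longleftrightarrow> (\<forall>k. Ck_on k f S)"

(* Elements of C_0^infinity(S) are represented by their extension by zero to the whole space. *)

definition test_functions :: "'a::euclidean_space set \<Rightarrow> ('a \<Rightarrow> real) set" where
  "test_functions S =
     {u. smooth_on u S \<and> compact (closure {x. u x \<noteq> 0}) \<and> closure {x. u x \<noteq> 0} \<subseteq> S}"

definition gradient :: "('a::euclidean_space \<Rightarrow> real) \<Rightarrow> 'a \<Rightarrow> 'a" where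
  "gradient u x = (\<Sum>b\<in>Basis. frechet_derivative u (at x) b *\<^sub>R b)"

lemma GDERIV_gradient:
  assumes "u differentiable (at x)"
  shows "GDERIV u x :> gradient u x"
proof -
  have D: "(u has_derivative frechet_derivative u (at x)) (at x)"
    using assms frechet_derivative_works by blast
  interpret linear "frechet_derivative u (at x)"
    using D has_derivative_linear by blast
  have "frechet_derivative u (at x) h = h \<bullet> gradient u x" for h
  proof -
    have "frechet_derivative u (at x) h
        = frechet_derivative u (at x) (\<Sum>b\<in>Basis. (h \<bullet> b) *\<^sub>R b)"
      by (simp only: euclidean_representation)
    also have "\<dots> = (\<Sum>b\<in>Basis. (h \<bullet> b) * frechet_derivative u (at x) b)"
      by (simp add: sum scale)
    also have "\<dots> = h \<bullet> gradient u x"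
      by (simp add: gradient_def inner_sum_right mult.commute)
    finally show ?thesis .
  qed
  then have "frechet_derivative u (at x) = (\<lambda>h. h \<bullet> gradient u x)" by blast
  with D show ?thesis by (simp add: gderiv_def)
qed

(* y is a positive classical solution on (0, R) of
     (A |y'|^(p-2) y')' + B |y|^(p-2) y = 0:
   y is C^1 and the flux A |y'|^(p-2) y' is differentiable. At zeros of y' the flux is 0
   (also for p < 2), in agreement with 0 powr (p - 2) * 0 = 0. *)

definition positive_ode_solution ::
    "real \<Rightarrow> ereal \<Rightarrow> (real \<Rightarrow> real) \<Rightarrow> (real \<Rightarrow> real) \<Rightarrow> (real \<Rightarrow> real) \<Rightarrow> bool" where
  "positive_ode_solution p R A B y \<longleftrightarrow>
     (\<forall>r\<in>radii R. y r > 0) \<and>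
     (\<forall>r\<in>radii R. y differentiable (at r)) \<and>
     continuous_on (radii R) (deriv y) \<and>
     (\<forall>r\<in>radii R.
        (\<lambda>s. A s * \<bar>deriv y s\<bar> powr (p - 2) * deriv y s) differentiable (at r) \<and>
        deriv (\<lambda>s. A s * \<bar>deriv y s\<bar> powr (p - 2) * deriv y s) r
          + B r * \<bar>y r\<bar> powr (p - 2) * y r = 0)"

definition p_Bessel_pair ::
    "real \<Rightarrow> ereal \<Rightarrow> (real \<Rightarrow> real) \<Rightarrow> (real \<Rightarrow> real) \<Rightarrow> bool" where
  "p_Bessel_pair p R A B \<longleftrightarrow> (\<exists>y. positive_ode_solution p R A B y)"

end

theory Submission
  imports Defs
begin

text \<open>Let \<open>\<rho> = \<phi>'/\<phi>\<close> and let \<open>n\<close> be the dimension. Dividing the flux of \<open>\<phi>\<close> by \<open>\<phi>\<^bsup>p-1\<^esup>\<close> turns the equation for \<open>\<phi>\<close> into the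
  Riccati equation
  \<open>(r\<^bsup>n-1\<^esup> V |\<rho>|\<^bsup>p-2\<^esup> \<rho>)' = - r\<^bsup>n-1\<^esup> (W + (p - 1) |\<rho>|\<^bsup>p\<^esup> V)\<close>
  (\<open>positive_ode_solution_Riccati\<close>). In other words, the radial field \<open>V |\<rho>|\<^bsup>p-2\<^esup> \<rho> x/|x|\<close> has divergence
  \<open>- (W + (p - 1) |\<rho>|\<^bsup>p\<^esup> V)\<close>. Integrating it by parts against \<open>|u|\<^bsup>p\<^esup>\<close>, whose support avoids the origin
  and the boundary, gives (\<open>integral_Riccati_weight\<close>)
  \<open>\<integral> (W + (p - 1) |\<rho>|\<^bsup>p\<^esup> V) |u|\<^bsup>p\<^esup> = p \<integral> V |\<rho>|\<^bsup>p-2\<^esup> \<rho> |u|\<^bsup>p-2\<^esup> u \<partial>\<^sub>r u \<le> p \<integral> V |\<rho> u|\<^bsup>p-1\<^esup> |\<partial>\<^sub>r u|\<close>,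
  where \<open>\<partial>\<^sub>r u\<close> is the radial derivative \<open>x/|x| \<bullet> \<nabla>u\<close>.

  Hoelder's inequality applied to the last integral is the second chain of inequalities. Young's
  inequality \<open>p |\<rho> u|\<^bsup>p-1\<^esup> |\<partial>\<^sub>r u| \<le> |\<partial>\<^sub>r u|\<^bsup>p\<^esup> + (p - 1) |\<rho> u|\<^bsup>p\<^esup>\<close> makes the terms with \<open>\<rho>\<close> on both sides cancel
  and leaves the Hardy inequality. The full gradient enters only through \<open>|\<partial>\<^sub>r u| \<le> |\<nabla>u|\<close>.

  The divergence theorem is needed only for radial fields, and there it is the statement that
  Lebesgue measure scales under dilations (\<open>integral_dilation_derivative_eq_0\<close>).\<close>

section \<open>Integrals invariant under dilation\<close>

lemma continuous_compact_support:
  fixes f :: "'a::euclidean_space \<Rightarrow> real"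
  assumes S: "open S" and C: "compact C" "C \<subseteq> S"
    and cont: "continuous_on S f" and zero: "\<And>x. x \<notin> C \<Longrightarrow> f x = 0"
  shows "continuous_on UNIV f" and "integrable lborel f"
proof -
  have "continuous_on (- C) f \<longleftrightarrow> continuous_on (- C) (\<lambda>_. 0 :: real)"
    by (intro continuous_on_cong) (auto simp: zero)
  then have "continuous_on (- C) f" by simp
  then have "continuous_on (S \<union> - C) f"
    using S C cont by (intro continuous_on_open_Un) (auto simp: compact_imp_closed)
  moreover have "S \<union> - C = UNIV" using C by auto
  ultimately show "continuous_on UNIV f" by simp
  have "integrable lborel (\<lambda>x. indicator C x *\<^sub>R f x)"
    using C continuous_on_subset[OF cont] by (intro borel_integrable_compact) auto
  moreover have "(\<lambda>x. indicator C x *\<^sub>R f x) = f"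
    using zero by (auto simp: indicator_def fun_eq_iff)
  ultimately show "integrable lborel f" by simp
qed

text \<open>The integral over the whole space of \<open>t\<^bsup>n\<^esup> f (t x)\<close>, with \<open>n\<close> the dimension, does not
  depend on \<open>t > 0\<close>, by the change of variables \<open>x \<mapsto> t x\<close>. Its derivative at \<open>t = 1\<close>, taken under the integral sign, is
  the integral of the divergence \<open>D\<close> of the field \<open>x \<mapsto> f(x) x\<close>. This yields the divergence theorem for
  radial fields from calculus along rays alone, in every dimension, without polar coordinates.\<close>

lemma integral_dilation_derivative_eq_0:
  fixes f D :: "'a::euclidean_space \<Rightarrow> real"
  assumes f: "continuous_on UNIV f" and D: "continuous_on UNIV D"
    and C: "compact C" and zero: "\<And>x. x \<notin> C \<Longrightarrow> f x = 0" "\<And>x. x \<notin> C \<Longrightarrow> D x = 0"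
    and deriv: "\<And>x t. 0 < t \<Longrightarrow>
      ((\<lambda>t. t ^ DIM('a) * f (t *\<^sub>R x)) has_real_derivative t ^ (DIM('a) - 1) * D (t *\<^sub>R x)) (at t)"
  shows "integral\<^sup>L lborel D = 0"
proof -
  obtain a where a: "C \<subseteq> cbox (- a) a"
    using compact_imp_bounded[OF C] bounded_subset_cbox_symmetric by blast
  let ?B = "cbox (- a) a"
  let ?F = "\<lambda>t x. t ^ DIM('a) * f (t *\<^sub>R x)"
  \<comment> \<open>Only \<open>t \<ge> 1\<close> is used, for then the support of the dilated function stays inside the same box.\<close>
  have const: "integral ?B (?F t) = integral ?B f" if t: "1 \<le> t" for t :: real
  proof -
    have "(f has_integral integral ?B f) ?B"
      using continuous_on_subset[OF f] by (intro integrable_integral integrable_continuous) auto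
    from has_integral_affinity'[OF this, of t 0] t
    have *: "((\<lambda>x. f (t *\<^sub>R x)) has_integral (integral ?B f /\<^sub>R t ^ DIM('a)))
           (cbox ((- a) /\<^sub>R t) (a /\<^sub>R t))" by simp
    have mem: "x \<in> cbox ((- a) /\<^sub>R t) (a /\<^sub>R t) \<longleftrightarrow> t *\<^sub>R x \<in> ?B" for x
      using t by (auto simp: mem_box field_simps)
    have sub: "cbox ((- a) /\<^sub>R t) (a /\<^sub>R t) \<subseteq> ?B"
    proof
      fix x assume "x \<in> cbox ((- a) /\<^sub>R t) (a /\<^sub>R t)"
      then have "\<bar>t * (x \<bullet> i)\<bar> \<le> a \<bullet> i" if "i \<in> Basis" for i
        using that unfolding mem by (force simp: mem_box)
      moreover have "\<bar>x \<bullet> i\<bar> \<le> \<bar>t * (x \<bullet> i)\<bar>" for i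
        using t mult_right_mono[of 1 t "\<bar>x \<bullet> i\<bar>"] by (simp add: abs_mult)
      ultimately have "\<bar>x \<bullet> i\<bar> \<le> a \<bullet> i" if "i \<in> Basis" for i
        using that order_trans by blast
      then show "x \<in> ?B" by (force simp: mem_box)
    qed
    have "((\<lambda>x. f (t *\<^sub>R x)) has_integral (integral ?B f /\<^sub>R t ^ DIM('a))) ?B"
      using * zero(1) a mem by (intro has_integral_on_superset[OF * _ sub]) blast
    from has_integral_mult_right[OF this, of "t ^ DIM('a)"] t show ?thesis
      by (intro integral_unique) (simp add: field_simps)
  qed
  have deriv_leibniz: "((\<lambda>t. integral ?B (?F t)) has_real_derivative
      integral ?B (\<lambda>x. 1 ^ (DIM('a) - 1) * D (1 *\<^sub>R x))) (at 1 within {1..2})"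
  proof (rule leibniz_rule_field_derivative[where fx = "\<lambda>t x. t ^ (DIM('a) - 1) * D (t *\<^sub>R x)"])
    show "((\<lambda>t. ?F t x) has_real_derivative t ^ (DIM('a) - 1) * D (t *\<^sub>R x)) (at t within {1..2})"
      if "t \<in> {1..2}" for t x
      using deriv[of t x] that by (auto intro: has_field_derivative_at_within)
    show "?F t integrable_on ?B" if "t \<in> {1..2}" for t
      by (intro integrable_continuous continuous_intros continuous_on_compose2[OF f]) auto
    show "continuous_on ({1..2} \<times> ?B) (\<lambda>(t, x). t ^ (DIM('a) - 1) * D (t *\<^sub>R x))"
      unfolding case_prod_beta
      by (intro continuous_intros continuous_on_compose2[OF D]) auto
  qed auto
  have deriv_const: "((\<lambda>t. integral ?B (?F t)) has_real_derivative 0) (at 1 within {1..2})"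
    by (rule has_field_derivative_transform_within[OF DERIV_const[of "integral ?B f"], where d = 1])
      (auto simp: const simp del: integral_mult_right)
  have "integral ?B D = 0"
    using has_field_derivative_unique[OF deriv_leibniz deriv_const]
    by (simp add: at_within_Icc_at_right)
  moreover have "integral ?B D = integral UNIV D"
    by (rule integral_unique[symmetric], rule has_integral_on_superset[where S = ?B])
      (use zero(2) a continuous_on_subset[OF D] in
        \<open>auto intro!: integrable_integral integrable_continuous\<close>)
  moreover have "integrable lborel D"
    using continuous_compact_support(2)[of UNIV C D] C D zero by auto
  ultimately show ?thesis using integral_lborel by metis
qed

section \<open>Signed powers\<close>

text \<open>The map \<open>s \<mapsto> |s|\<^bsup>q-1\<^esup> s\<close> of the \<open>p\<close>-Laplacian, for \<open>q = p - 1\<close>. In this form it is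
  visibly continuous and multiplicative for all \<open>q > 0\<close>, whereas \<open>|s|\<^bsup>q-1\<^esup>\<close> is unbounded near \<open>0\<close> if
  \<open>q < 1\<close>.\<close>

definition signed_powr :: "real \<Rightarrow> real \<Rightarrow> real" where
  "signed_powr q s = sgn s * \<bar>s\<bar> powr q"

lemma signed_powr_alt: "\<bar>s\<bar> powr (p - 2) * s = signed_powr (p - 1) s"
proof (cases "s = 0")
  case False
  then have "\<bar>s\<bar> powr (p - 1) = \<bar>s\<bar> powr (p - 2) * \<bar>s\<bar>"
    using powr_add[of "\<bar>s\<bar>" "p - 2" 1] by simp
  then show ?thesis by (auto simp: signed_powr_def sgn_if)
qed (simp add: signed_powr_def)

lemma signed_powr_mult: "signed_powr q (s * t) = signed_powr q s * signed_powr q t"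
  by (simp add: signed_powr_def sgn_mult abs_mult powr_mult)

lemma signed_powr_pos: "0 < s \<Longrightarrow> signed_powr q s = s powr q"
  by (simp add: signed_powr_def)

lemma abs_signed_powr: "\<bar>signed_powr q s\<bar> = \<bar>s\<bar> powr q"
  by (simp add: signed_powr_def abs_mult abs_sgn_eq)

lemma signed_powr_times: "signed_powr (p - 1) s * s = \<bar>s\<bar> powr p"
proof (cases "s = 0")
  case False
  then have "\<bar>s\<bar> powr p = \<bar>s\<bar> powr (p - 1) * \<bar>s\<bar>"
    using powr_add[of "\<bar>s\<bar>" "p - 1" 1] by simp
  then show ?thesis by (auto simp: signed_powr_def sgn_if)
qed (simp add: signed_powr_def)

lemma continuous_on_signed_powr [continuous_intros]:
  assumes q: "0 < q" and f: "continuous_on S f"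
  shows "continuous_on S (\<lambda>x. signed_powr q (f x))"
proof -
  have "signed_powr q s = max s 0 powr q - max (- s) 0 powr q" for s
    using q by (cases s "0 :: real" rule: linorder_cases) (auto simp: signed_powr_def)
  then show ?thesis
    using q by (auto intro!: continuous_intros continuous_on_powr' f)
qed

lemma has_real_derivative_abs_powr:
  assumes p: "1 < p"
  shows "((\<lambda>s. \<bar>s\<bar> powr p) has_real_derivative p * signed_powr (p - 1) s) (at s)"
proof (cases s "0 :: real" rule: linorder_cases)
  case equal
  have "continuous_on UNIV (\<lambda>s. signed_powr (p - 1) s)"
    using p by (intro continuous_intros) auto
  then have "isCont (signed_powr (p - 1)) 0"
    by (simp add: continuous_on_eq_continuous_at)
  then have "signed_powr (p - 1) \<midarrow>0\<rightarrow> 0"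
    by (simp add: isCont_def signed_powr_def)
  moreover have "\<bar>h\<bar> powr p / h = signed_powr (p - 1) h" for h
    using signed_powr_times[of p h] by (cases "h = 0") (auto simp: field_simps signed_powr_def)
  ultimately have "(\<lambda>h. \<bar>h\<bar> powr p / h) \<midarrow>0\<rightarrow> 0" by simp
  then show ?thesis
    using p equal by (simp add: DERIV_def signed_powr_def)
next
  case greater
  have "((\<lambda>s. s powr p) has_real_derivative p * signed_powr (p - 1) s) (at s)"
    using has_real_derivative_powr[OF greater, of p] greater by (simp add: signed_powr_def)
  then show ?thesis
    by (rule has_field_derivative_transform_within_open[of _ _ _ "{0<..}"]) (use greater in auto)
next
  case less
  have "((\<lambda>s. (- s) powr p) has_real_derivative p * signed_powr (p - 1) s) (at s)"
    using less by (auto intro!: derivative_eq_intros simp: signed_powr_def powr_diff)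
  then show ?thesis
    by (rule has_field_derivative_transform_within_open[of _ _ _ "{..<0}"]) (use less in auto)
qed

section \<open>Inequalities of Young and Hoelder\<close>

lemma Young_powr:
  fixes f g p :: real
  assumes p: "1 < p" and "0 \<le> f" "0 \<le> g"
  shows "f * g powr (p - 1) \<le> f powr p / p + (p - 1) / p * g powr p"
proof -
  have "f * g powr (p - 1) \<le> f powr p / p + (g powr (p - 1)) powr (p / (p - 1)) / (p / (p - 1))"
    using assms by (intro Youngs_inequality) (auto simp: field_simps)
  then show ?thesis using p by (simp add: powr_powr mult.commute)
qed

text \<open>Hoelder's inequality for the exponents \<open>p\<close> and \<open>p/(p-1)\<close>, in the form in which the second function
  is itself a power of exponent \<open>p - 1\<close>. It follows from Young's inequality for the functions divided by
  their norms.\<close>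

lemma Holder_powr:
  fixes f g :: "'a \<Rightarrow> real"
  assumes p: "1 < p" and nonneg: "\<And>x. 0 \<le> f x" "\<And>x. 0 \<le> g x"
    and int: "integrable M (\<lambda>x. f x powr p)" "integrable M (\<lambda>x. g x powr p)"
      "integrable M (\<lambda>x. f x * g x powr (p - 1))"
  shows "(LINT x|M. f x * g x powr (p - 1))
    \<le> (LINT x|M. f x powr p) powr (1 / p) * (LINT x|M. g x powr p) powr ((p - 1) / p)"
proof -
  define a b where "a = (LINT x|M. f x powr p)" and "b = (LINT x|M. g x powr p)"
  have ab: "0 \<le> a" "0 \<le> b" unfolding a_def b_def by (auto intro: integral_nonneg_AE)
  show ?thesis
  proof (cases "a = 0 \<or> b = 0")
    case True
    then have "AE x in M. f x = 0 \<or> g x = 0"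
    proof
      assume "a = 0"
      then have "AE x in M. f x powr p = 0"
        using integral_nonneg_eq_0_iff_AE[OF int(1)] by (simp add: a_def)
      then show ?thesis by eventually_elim auto
    next
      assume "b = 0"
      then have "AE x in M. g x powr p = 0"
        using integral_nonneg_eq_0_iff_AE[OF int(2)] by (simp add: b_def)
      then show ?thesis by eventually_elim auto
    qed
    then have "(LINT x|M. f x * g x powr (p - 1)) = 0"
      by (intro integral_eq_zero_AE) auto
    then show ?thesis by simp
  next
    case False
    with ab have pos: "0 < a" "0 < b" by auto
    define \<alpha> \<beta> where "\<alpha> = a powr (1 / p)" and "\<beta> = b powr (1 / p)"
    have \<alpha>\<beta>: "0 < \<alpha>" "0 < \<beta>" "\<alpha> powr p = a" "\<beta> powr p = b" "\<beta> powr (p - 1) = b powr ((p - 1) / p)"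
      using pos p by (auto simp: \<alpha>_def \<beta>_def powr_powr)
    have le: "f x * g x powr (p - 1) / (\<alpha> * \<beta> powr (p - 1))
        \<le> f x powr p / (p * a) + (p - 1) / p * (g x powr p / b)" for x
      using Young_powr[OF p, of "f x / \<alpha>" "g x / \<beta>"] nonneg[of x] \<alpha>\<beta>
      by (simp add: powr_divide field_simps)
    have "(LINT x|M. f x * g x powr (p - 1) / (\<alpha> * \<beta> powr (p - 1)))
        \<le> (LINT x|M. f x powr p / (p * a) + (p - 1) / p * (g x powr p / b))"
      using int le by (intro integral_mono) auto
    also have "\<dots> = a / (p * a) + (p - 1) / p * (b / b)"
      using int by (simp add: a_def b_def)
    also have "\<dots> = 1" using pos p by (simp add: field_simps)
    finally show ?thesis
      using \<alpha>\<beta> pos by (simp add: a_def[symmetric] b_def[symmetric] \<alpha>_def[symmetric] divide_le_eq)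
  qed
qed

section \<open>Radial functions and test functions\<close>

lemma open_radii: "open (radii R)"
proof -
  have "radii R = {0<..} \<inter> {r. ereal r < R}" by (auto simp: radii_def)
  moreover have "open {r. ereal r < R}"
    by (intro open_Collect_less continuous_on_ereal continuous_on_id continuous_on_const)
  ultimately show ?thesis by (simp add: open_Int)
qed

lemma open_punctured_eball0: "open (eball0 R - {0 :: 'a::euclidean_space})"
  unfolding eball0_def by (intro open_Diff open_Collect_less continuous_on_ereal continuous_on_norm_id
      continuous_on_const closed_singleton)

lemma norm_in_radii: "x \<in> eball0 R - {0} \<Longrightarrow> norm x \<in> radii R"
  by (auto simp: eball0_def radii_def)

lemma continuous_on_radial:
  assumes "continuous_on (radii R) k"
  shows "continuous_on (eball0 R - {0}) (\<lambda>x. k (norm x))"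
  using norm_in_radii by (intro continuous_on_compose2[OF assms] continuous_on_norm_id) blast

lemma smooth_on_imp_continuous_on: "smooth_on f S \<Longrightarrow> continuous_on S f"
  unfolding smooth_on_def using Ck_on.simps(1) by blast

lemma test_functionE:
  fixes u :: "'a::euclidean_space \<Rightarrow> real"
  assumes u: "u \<in> test_functions S"
  obtains C where "compact C" "C \<subseteq> S" "\<And>x. x \<notin> C \<Longrightarrow> u x = 0" "\<And>x. x \<notin> C \<Longrightarrow> gradient u x = 0"
    "continuous_on S u" "continuous_on S (gradient u)" "\<And>x. x \<in> S \<Longrightarrow> GDERIV u x :> gradient u x"
proof -
  define C where "C = closure {x. u x \<noteq> 0}"
  have smooth: "smooth_on u S" and C: "compact C" "C \<subseteq> S"
    using u by (simp_all add: test_functions_def C_def)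
  from smooth have "Ck_on (Suc 0) u S" unfolding smooth_on_def by blast
  then have diff: "u differentiable (at x)" if "x \<in> S" for x
    using that by simp
  have cont: "continuous_on S (\<lambda>x. frechet_derivative u (at x) v)" for v
    using \<open>Ck_on (Suc 0) u S\<close> by simp
  have zero: "u x = 0" if "x \<notin> C" for x
    using that closure_subset[of "{x. u x \<noteq> 0}"] by (auto simp: C_def)
  have "gradient u x = 0" if "x \<notin> C" for x
  proof -
    have "(u has_derivative (\<lambda>_. 0)) (at x)"
    proof (rule has_derivative_transform_within_open)
      show "((\<lambda>_. 0) has_derivative (\<lambda>_. 0)) (at x)" by simp
      show "open (- C)" "x \<in> - C" using that by (auto simp: C_def)
      show "0 = u y" if "y \<in> - C" for y using that zero by simp
    qed
    then have "frechet_derivative u (at x) = (\<lambda>_. 0)"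
      using frechet_derivative_at by metis
    then show ?thesis by (simp add: gradient_def)
  qed
  moreover have "continuous_on S u" using smooth by (rule smooth_on_imp_continuous_on)
  moreover have "continuous_on S (gradient u)"
    unfolding gradient_def[abs_def] by (intro continuous_intros cont)
  ultimately show ?thesis
    using that C zero GDERIV_gradient[OF diff] by blast
qed

section \<open>The divergence theorem for radial fields\<close>

text \<open>The integrand is the divergence of the field \<open>|x|\<^bsup>1-n\<^esup> K(|x|) v(x) x/|x|\<close>, where \<open>n\<close>
  is the dimension: the factor \<open>|x|\<^bsup>1-n\<^esup> x/|x|\<close> has divergence zero away from the origin, so only the radial
  derivative of \<open>K(|x|) v(x)\<close> survives. The support of \<open>v\<close> avoids the origin and the sphere of
  radius \<open>R\<close>, hence there are no boundary terms.\<close>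

lemma integral_divergence_radial_field:
  fixes v :: "'a::euclidean_space \<Rightarrow> real" and g :: "'a \<Rightarrow> 'a"
  assumes K: "\<And>r. r \<in> radii R \<Longrightarrow> (K has_real_derivative K' r) (at r)"
    and K': "continuous_on (radii R) K'"
    and v: "\<And>x. x \<in> eball0 R - {0} \<Longrightarrow> GDERIV v x :> g x"
    and g: "continuous_on (eball0 R - {0}) g"
    and C: "compact C" "C \<subseteq> eball0 R - {0}"
    and zero: "\<And>x. x \<notin> C \<Longrightarrow> v x = 0" "\<And>x. x \<notin> C \<Longrightarrow> g x = 0"
  defines "D \<equiv> \<lambda>x. (K' (norm x) * v x + K (norm x) * ((x /\<^sub>R norm x) \<bullet> g x)) / norm x ^ (DIM('a) - 1)"
  shows "integrable lborel D" and "integral\<^sup>L lborel D = 0"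
proof -
  let ?S = "eball0 R - {0 :: 'a}"
  define f where "f = (\<lambda>x :: 'a. K (norm x) / norm x ^ DIM('a) * v x)"
  have "continuous_on (radii R) K"
    by (intro continuous_at_imp_continuous_on ballI DERIV_isCont[OF K])
  note cont_K = continuous_on_radial[OF this] continuous_on_radial[OF K']
  have cont_v: "continuous_on ?S v"
    using v by (intro continuous_at_imp_continuous_on ballI) (auto simp: gderiv_def intro: has_derivative_continuous)
  have cont_D: "continuous_on ?S D" unfolding D_def
    by (intro continuous_intros cont_K cont_v g) auto
  have cont_f: "continuous_on ?S f" unfolding f_def
    by (intro continuous_intros cont_K cont_v) auto
  have D0: "D x = 0" and f0: "f x = 0" if "x \<notin> C" for x
    using zero that by (auto simp: D_def f_def)
  note D = continuous_compact_support[OF open_punctured_eball0 C cont_D D0]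
  note f = continuous_compact_support[OF open_punctured_eball0 C cont_f f0]
  show "integrable lborel D" by (rule D)
  show "integral\<^sup>L lborel D = 0"
  proof (rule integral_dilation_derivative_eq_0[OF f(1) D(1) C(1) f0 D0])
    fix x :: 'a and t :: real assume t: "0 < t"
    show "((\<lambda>t. t ^ DIM('a) * f (t *\<^sub>R x)) has_real_derivative t ^ (DIM('a) - 1) * D (t *\<^sub>R x)) (at t)"
    proof (cases "t *\<^sub>R x \<in> ?S")
      case True
      define r where "r = norm x"
      have r: "0 < r" "t * r \<in> radii R" using True t norm_in_radii[OF True] by (auto simp: r_def)
      obtain n where n: "DIM('a) = Suc n" using DIM_positive[where 'a = 'a] gr0_implies_Suc by blast
      have "(v has_derivative (\<lambda>h. h \<bullet> g (t *\<^sub>R x))) (at (t *\<^sub>R x))"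
        using v[OF True] by (simp add: gderiv_def)
      moreover have "((\<lambda>t. t *\<^sub>R x) has_derivative (\<lambda>h. h *\<^sub>R x)) (at t)"
        by (auto intro!: derivative_eq_intros)
      ultimately have "((\<lambda>t. v (t *\<^sub>R x)) has_derivative (\<lambda>h. (h *\<^sub>R x) \<bullet> g (t *\<^sub>R x))) (at t)"
        by (rule has_derivative_compose[rotated])
      then have dv: "((\<lambda>t. v (t *\<^sub>R x)) has_real_derivative x \<bullet> g (t *\<^sub>R x)) (at t)"
        by (rule has_derivative_imp_has_field_derivative) simp
      have dK: "((\<lambda>t. K (t * r)) has_real_derivative K' (t * r) * r) (at t)"
        by (rule DERIV_chain2[where f = K and g = "\<lambda>t. t * r" and x = t, OF K[OF r(2)]]) (auto intro!: derivative_eq_intros)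
      \<comment> \<open>The powers of \<open>t\<close> in \<open>t\<^bsup>n\<^esup> f (t x)\<close> cancel; what is left depends on \<open>t\<close> only through \<open>K\<close> and \<open>v\<close>.\<close>
      have "((\<lambda>t. K (t * r) / r ^ DIM('a) * v (t *\<^sub>R x)) has_real_derivative
          (K' (t * r) * r) / r ^ DIM('a) * v (t *\<^sub>R x) + K (t * r) / r ^ DIM('a) * (x \<bullet> g (t *\<^sub>R x))) (at t)"
        using r by (auto intro!: derivative_eq_intros dK dv simp: add_divide_distrib mult_ac)
      also have "(K' (t * r) * r) / r ^ DIM('a) * v (t *\<^sub>R x) + K (t * r) / r ^ DIM('a) * (x \<bullet> g (t *\<^sub>R x))
          = t ^ (DIM('a) - 1) * D (t *\<^sub>R x)"
      proof -
        have *: "k' * r / r ^ Suc n * w + k / r ^ Suc n * i = t ^ n * ((k' * w + k * (i / r)) / (t * r) ^ n)"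
          for k k' w i :: real
          using r t by (simp add: power_mult_distrib add_divide_distrib distrib_left)
        have norm: "norm (t *\<^sub>R x) = t * r" using t by (simp add: r_def)
        then have "((t *\<^sub>R x) /\<^sub>R norm (t *\<^sub>R x)) \<bullet> g (t *\<^sub>R x) = (x \<bullet> g (t *\<^sub>R x)) / r"
          using r t by (simp add: divide_simps)
        then show ?thesis unfolding D_def norm n by (simp only: * diff_Suc_1)
      qed
      finally show ?thesis
      proof (rule has_field_derivative_transform_within_open[of _ _ _ "{0<..}"])
        show "K (s * r) / r ^ DIM('a) * v (s *\<^sub>R x) = s ^ DIM('a) * f (s *\<^sub>R x)" if "s \<in> {0<..}" for s
          using that by (simp add: f_def r_def[symmetric] power_mult_distrib)
      qed (use t in auto)
    next
      case False
      then have "t *\<^sub>R x \<notin> C" using C by blast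
      have "((\<lambda>t. t ^ DIM('a) * f (t *\<^sub>R x)) has_real_derivative 0) (at t)"
      proof (rule has_field_derivative_transform_within_open[OF DERIV_const])
        show "open ((\<lambda>t. t *\<^sub>R x) -` (- C))"
          using C by (intro open_vimage) (auto intro!: continuous_intros simp: compact_imp_closed)
        show "t \<in> (\<lambda>t. t *\<^sub>R x) -` (- C)" using \<open>t *\<^sub>R x \<notin> C\<close> by simp
        show "0 = t ^ DIM('a) * f (t *\<^sub>R x)" if "t \<in> (\<lambda>t. t *\<^sub>R x) -` (- C)" for t
          using that f0 by simp
      qed
      then show ?thesis using D0[OF \<open>t *\<^sub>R x \<notin> C\<close>] by simp
    qed
  qed
qed

section \<open>The Riccati equation\<close>

text \<open>The substitution that turns a half-linear equation of second order into a Riccati equation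
  of first order: dividing the flux \<open>A |y'|\<^bsup>p-2\<^esup> y'\<close> by \<open>y\<^bsup>p-1\<^esup>\<close> removes \<open>y\<close> from the term with \<open>B\<close>.
  Only the flux is differentiated, never \<open>A\<close> or \<open>y'\<close> separately, since \<open>y\<close> may fail to be twice
  differentiable where \<open>y'\<close> vanishes.\<close>

lemma positive_ode_solution_Riccati:
  assumes sol: "positive_ode_solution p R A B y" and r: "r \<in> radii R"
  shows "((\<lambda>r. A r * signed_powr (p - 1) (deriv y r / y r)) has_real_derivative
    - (B r + (p - 1) * (A r * \<bar>deriv y r / y r\<bar> powr p))) (at r)"
proof -
  define F where "F = (\<lambda>s. A s * signed_powr (p - 1) (deriv y s))"
  have pos: "0 < y s" if "s \<in> radii R" for s
    using sol that by (simp add: positive_ode_solution_def)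
  have "F = (\<lambda>s. A s * \<bar>deriv y s\<bar> powr (p - 2) * deriv y s)"
    by (simp add: F_def signed_powr_alt[symmetric] mult.assoc)
  then have diff: "F differentiable (at r)"
    and "deriv F r + B r * (\<bar>y r\<bar> powr (p - 2) * y r) = 0"
    using sol r by (auto simp: positive_ode_solution_def mult.assoc)
  then have "deriv F r = - B r * y r powr (p - 1)"
    using pos[OF r] signed_powr_alt[of "y r" p] by (simp add: signed_powr_pos)
  with diff have dF: "(F has_real_derivative - B r * y r powr (p - 1)) (at r)"
    by (metis DERIV_deriv_iff_real_differentiable)
  have dy: "(y has_real_derivative deriv y r) (at r)"
    using sol r by (simp add: positive_ode_solution_def DERIV_deriv_iff_real_differentiable)
  have dpow: "((\<lambda>s. y s powr (1 - p)) has_real_derivative (1 - p) * y r powr (- p) * deriv y r) (at r)"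
    using DERIV_fun_powr[OF dy pos[OF r], of "1 - p"] by simp
  have "((\<lambda>s. F s * y s powr (1 - p)) has_real_derivative
      - B r * y r powr (p - 1) * y r powr (1 - p) + F r * ((1 - p) * y r powr (- p) * deriv y r)) (at r)"
    using DERIV_mult[OF dF dpow] by (simp add: mult_ac add_ac)
  also have "- B r * y r powr (p - 1) * y r powr (1 - p) + F r * ((1 - p) * y r powr (- p) * deriv y r)
      = - (B r * (y r powr (p - 1) * y r powr (1 - p))
          + (p - 1) * (A r * (signed_powr (p - 1) (deriv y r) * deriv y r) * y r powr (- p)))"
    by (simp add: F_def algebra_simps)
  also have "\<dots> = - (B r + (p - 1) * (A r * \<bar>deriv y r / y r\<bar> powr p))"
    unfolding signed_powr_times using pos[OF r]
    by (simp add: powr_add[symmetric] powr_divide powr_minus field_simps)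
  finally show ?thesis
  proof (rule has_field_derivative_transform_within_open[OF _ open_radii r])
    fix s assume s: "s \<in> radii R"
    have "signed_powr (p - 1) (deriv y s / y s) = signed_powr (p - 1) (deriv y s) * signed_powr (p - 1) (1 / y s)"
      by (simp add: signed_powr_mult[symmetric])
    also have "signed_powr (p - 1) (1 / y s) = y s powr (1 - p)"
      using pos[OF s] by (simp add: signed_powr_pos powr_divide powr_diff)
    finally show "F s * y s powr (1 - p) = A s * signed_powr (p - 1) (deriv y s / y s)"
      by (simp add: F_def)
  qed
qed

lemma GDERIV_abs_powr:
  assumes p: "1 < p" and u: "GDERIV u x :> g"
  shows "GDERIV (\<lambda>x. \<bar>u x\<bar> powr p) x :> (p * signed_powr (p - 1) (u x)) *\<^sub>R g"
  by (rule GDERIV_DERIV_compose[OF u has_real_derivative_abs_powr[OF p]])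

lemma continuous_on_abs_powr:
  assumes "0 < (p :: real)" "continuous_on S f"
  shows "continuous_on S (\<lambda>x. \<bar>f x :: real\<bar> powr p)"
  using assms by (intro continuous_on_powr' continuous_on_rabs continuous_on_const) auto

lemma set_integral_eq_integral:
  fixes f :: "'a \<Rightarrow> real"
  assumes "\<And>x. x \<notin> A \<Longrightarrow> f x = 0"
  shows "(LINT x:A|M. f x) = integral\<^sup>L M f"
  unfolding set_lebesgue_integral_def
  by (rule Bochner_Integration.integral_cong) (use assms in \<open>auto simp: indicator_def\<close>)

lemma continuous_on_logarithmic_derivative:
  assumes "positive_ode_solution p R A B y"
  shows "continuous_on (radii R) (\<lambda>r. deriv y r / y r)"
proof -
  have pos: "\<forall>r\<in>radii R. 0 < y r" and diff: "\<forall>r\<in>radii R. y differentiable (at r)"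
    and cont: "continuous_on (radii R) (deriv y)"
    using assms by (simp_all add: positive_ode_solution_def)
  have "continuous_on (radii R) y"
    using diff by (intro continuous_at_imp_continuous_on ballI differentiable_imp_continuous_within) auto
  with cont show ?thesis using pos by (intro continuous_on_divide) force+
qed

text \<open>Integration by parts, with no boundary terms, against the field
  \<open>|\<phi>'/\<phi>|\<^bsup>p-2\<^esup> (\<phi>'/\<phi>) V x/|x|\<close>: the Riccati equation says that its divergence is
  \<open>- (W + (p - 1) |\<phi>'/\<phi>|\<^bsup>p\<^esup> V)\<close>. The differentiability of \<open>|u|\<^bsup>p\<^esup>\<close> across the zeros
  of \<open>u\<close> is where \<open>p > 1\<close> enters.\<close>

lemma integral_Riccati_weight:
  fixes u :: "'a::euclidean_space \<Rightarrow> real"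
  assumes p: "1 < p" and cont_V: "continuous_on (radii R) V" and cont_W: "continuous_on (radii R) W"
    and sol: "positive_ode_solution p R (\<lambda>r. r ^ (DIM('a) - 1) * V r) (\<lambda>r. r ^ (DIM('a) - 1) * W r) \<phi>"
    and u: "u \<in> test_functions (eball0 R - {0})"
  defines "\<rho> \<equiv> \<lambda>r. deriv \<phi> r / \<phi> r"
  shows "has_bochner_integral lborel
    (\<lambda>x. p * (V (norm x) * signed_powr (p - 1) (\<rho> (norm x)) * signed_powr (p - 1) (u x)
            * ((x /\<^sub>R norm x) \<bullet> gradient u x))
       - (W (norm x) + (p - 1) * \<bar>\<rho> (norm x)\<bar> powr p * V (norm x)) * \<bar>u x\<bar> powr p) 0"
proof -
  let ?S = "eball0 R - {0 :: 'a}"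
  let ?n = "DIM('a) - 1"
  obtain C where C: "compact C" "C \<subseteq> ?S" and u0: "\<And>x. x \<notin> C \<Longrightarrow> u x = 0"
    and "\<And>x. x \<notin> C \<Longrightarrow> gradient u x = 0"
    and cont_u: "continuous_on ?S u" and cont_grad: "continuous_on ?S (gradient u)"
    and grad: "\<And>x. x \<in> ?S \<Longrightarrow> GDERIV u x :> gradient u x"
    using test_functionE[OF u] by blast
  have cont_\<rho>: "continuous_on (radii R) \<rho>"
    unfolding \<rho>_def by (rule continuous_on_logarithmic_derivative[OF sol])
  define K where "K = (\<lambda>r. r ^ ?n * V r * signed_powr (p - 1) (\<rho> r))"
  define K' where "K' = (\<lambda>r. - (r ^ ?n * W r + (p - 1) * (r ^ ?n * V r * \<bar>\<rho> r\<bar> powr p)))"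
  define v where "v = (\<lambda>x. \<bar>u x\<bar> powr p)"
  define v' where "v' = (\<lambda>x. (p * signed_powr (p - 1) (u x)) *\<^sub>R gradient u x)"
  define D where "D = (\<lambda>x. (K' (norm x) * v x + K (norm x) * ((x /\<^sub>R norm x) \<bullet> v' x)) / norm x ^ ?n)"
  have 1: "(K has_real_derivative K' r) (at r)" if "r \<in> radii R" for r
    using positive_ode_solution_Riccati[OF sol that] by (simp add: K_def K'_def \<rho>_def)
  have 2: "continuous_on (radii R) K'" unfolding K'_def
    using p by (intro continuous_intros continuous_on_abs_powr cont_V cont_W cont_\<rho>) auto
  have 3: "GDERIV v x :> v' x" if "x \<in> ?S" for x
    unfolding v_def v'_def by (rule GDERIV_abs_powr[OF p grad[OF that]])
  have 4: "continuous_on ?S v'" unfolding v'_def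
    using p by (intro continuous_intros cont_u cont_grad) auto
  have "integrable lborel D" "integral\<^sup>L lborel D = 0"
    unfolding D_def using integral_divergence_radial_field[OF 1 2 3 4 C] u0
    by (auto simp: v_def v'_def signed_powr_def)
  then have "has_bochner_integral lborel D 0"
    by (simp add: has_bochner_integral_iff)
  moreover have "D x = p * (V (norm x) * signed_powr (p - 1) (\<rho> (norm x)) * signed_powr (p - 1) (u x)
            * ((x /\<^sub>R norm x) \<bullet> gradient u x))
       - (W (norm x) + (p - 1) * \<bar>\<rho> (norm x)\<bar> powr p * V (norm x)) * \<bar>u x\<bar> powr p" for x
  proof (cases "x \<in> C")
    case True
    then have "x \<noteq> 0" using C by blast
    have *: "(- (s * w + (p - 1) * (s * V' * q)) * z + s * V' * \<sigma> * (p * \<tau> * d)) / s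
        = p * (V' * \<sigma> * \<tau> * d) - (w + (p - 1) * q * V') * z" if "s \<noteq> 0" for s w V' q z \<sigma> \<tau> d :: real
    proof -
      have "- (s * w + (p - 1) * (s * V' * q)) * z + s * V' * \<sigma> * (p * \<tau> * d)
          = s * (p * (V' * \<sigma> * \<tau> * d) - (w + (p - 1) * q * V') * z)"
        by (simp add: algebra_simps)
      with that show ?thesis by simp
    qed
    show ?thesis
      unfolding D_def K_def K'_def v_def v'_def inner_scaleR_right
      using \<open>x \<noteq> 0\<close> by (intro *) simp
  next
    case False
    then show ?thesis using u0 by (simp add: D_def v_def v'_def signed_powr_def)
  qed
  ultimately show ?thesis by (simp cong: has_bochner_integral_cong)
qed

section \<open>The Hardy and Caffarelli-Kohn-Nirenberg inequalities\<close>

theorem theorem1p6: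
  fixes p :: real and R :: ereal and V W :: "real \<Rightarrow> real"
  assumes p: "p > 1"
    and R: "0 < R"
    and V_smooth: "smooth_on V (radii R)"
    and W_smooth: "smooth_on W (radii R)"
    and V_nonneg: "\<And>r. r \<in> radii R \<Longrightarrow> V r \<ge> 0"
    and Bessel: "p_Bessel_pair p R (\<lambda>r. r ^ (DIM('a::euclidean_space) - 1) * V r)
                                   (\<lambda>r. r ^ (DIM('a) - 1) * W r)"
  shows "\<forall>\<phi>. positive_ode_solution p R (\<lambda>r. r ^ (DIM('a) - 1) * V r)
                                        (\<lambda>r. r ^ (DIM('a) - 1) * W r) \<phi> \<longrightarrow>
    (\<forall>u \<in> test_functions (eball0 R - {0 :: 'a}).
      (LINT x:eball0 R|lborel. V (norm x) * norm (gradient u x) powr p)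
        \<ge> (LINT x:eball0 R|lborel. V (norm x) * \<bar>(x /\<^sub>R norm x) \<bullet> gradient u x\<bar> powr p)
      \<and> (LINT x:eball0 R|lborel. V (norm x) * \<bar>(x /\<^sub>R norm x) \<bullet> gradient u x\<bar> powr p)
        \<ge> (LINT x:eball0 R|lborel. W (norm x) * \<bar>u x\<bar> powr p)
      \<and> (LINT x:eball0 R|lborel. V (norm x) * norm (gradient u x) powr p) powr (1 / p)
          * (LINT x:eball0 R|lborel.
               \<bar>deriv \<phi> (norm x) / \<phi> (norm x)\<bar> powr p * V (norm x) * \<bar>u x\<bar> powr p) powr ((p - 1) / p)
        \<ge> (LINT x:eball0 R|lborel. V (norm x) * \<bar>(x /\<^sub>R norm x) \<bullet> gradient u x\<bar> powr p) powr (1 / p)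
          * (LINT x:eball0 R|lborel.
               \<bar>deriv \<phi> (norm x) / \<phi> (norm x)\<bar> powr p * V (norm x) * \<bar>u x\<bar> powr p) powr ((p - 1) / p)
      \<and> (LINT x:eball0 R|lborel. V (norm x) * \<bar>(x /\<^sub>R norm x) \<bullet> gradient u x\<bar> powr p) powr (1 / p)
          * (LINT x:eball0 R|lborel.
               \<bar>deriv \<phi> (norm x) / \<phi> (norm x)\<bar> powr p * V (norm x) * \<bar>u x\<bar> powr p) powr ((p - 1) / p)
        \<ge> 1 / p * (LINT x:eball0 R|lborel.
               (W (norm x) + (p - 1) * \<bar>deriv \<phi> (norm x) / \<phi> (norm x)\<bar> powr p * V (norm x))
               * \<bar>u x\<bar> powr p))"
proof (intro allI impI ballI)
  fix \<phi> and u :: "'a \<Rightarrow> real"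
  assume sol: "positive_ode_solution p R (\<lambda>r. r ^ (DIM('a) - 1) * V r) (\<lambda>r. r ^ (DIM('a) - 1) * W r) \<phi>"
    and u: "u \<in> test_functions (eball0 R - {0})"
  let ?S = "eball0 R - {0 :: 'a}"
  define \<rho> where "\<rho> = (\<lambda>r. deriv \<phi> r / \<phi> r)"
  define d where "d = (\<lambda>x. (x /\<^sub>R norm x) \<bullet> gradient u x)"
  \<comment> \<open>Chosen so that \<open>f\<^bsup>p\<^esup>\<close> and \<open>g\<^bsup>p\<^esup>\<close> are the integrands in the middle term of the second chain,
    while \<open>f g\<^bsup>p-1\<^esup>\<close> bounds what remains after integrating by parts.\<close>
  define f where "f = (\<lambda>x. V (norm x) powr (1 / p) * \<bar>d x\<bar>)"
  define g where "g = (\<lambda>x. V (norm x) powr (1 / p) * (\<bar>\<rho> (norm x)\<bar> * \<bar>u x\<bar>))"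
  obtain C where C: "compact C" "C \<subseteq> ?S" and u0: "\<And>x. x \<notin> C \<Longrightarrow> u x = 0"
    and grad0: "\<And>x. x \<notin> C \<Longrightarrow> gradient u x = 0" and cont_u: "continuous_on ?S u"
    and cont_grad: "continuous_on ?S (gradient u)"
    and "\<And>x. x \<in> ?S \<Longrightarrow> GDERIV u x :> gradient u x"
    using test_functionE[OF u] by blast
  have d0: "d x = 0" if "x \<notin> C" for x using grad0[OF that] by (simp add: d_def)
  have V: "0 \<le> V (norm x)" if "x \<in> ?S" for x
    using V_nonneg norm_in_radii[OF that] by blast
  have VC: "0 \<le> V (norm x)" if "x \<in> C" for x using V C that by blast
  have cont_V: "continuous_on (radii R) V" and cont_W: "continuous_on (radii R) W"
    using V_smooth W_smooth by (auto intro: smooth_on_imp_continuous_on)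
  have cont_\<rho>: "continuous_on (radii R) \<rho>"
    unfolding \<rho>_def by (rule continuous_on_logarithmic_derivative[OF sol])
  have cont_d: "continuous_on ?S d"
    unfolding d_def by (intro continuous_intros cont_grad) auto
  note cont = continuous_on_radial[OF cont_V] continuous_on_radial[OF cont_W]
    continuous_on_radial[OF cont_\<rho>] cont_d cont_u cont_grad
  have int: "integrable lborel h" if "continuous_on ?S h" "\<And>x. x \<notin> C \<Longrightarrow> h x = 0" for h :: "'a \<Rightarrow> real"
    using continuous_compact_support(2)[OF open_punctured_eball0 C that] .
  have set_int: "(LINT x:eball0 R|lborel. h x) = integral\<^sup>L lborel h"
    if "\<And>x. x \<notin> C \<Longrightarrow> h x = 0" for h :: "'a \<Rightarrow> real"
    using that C by (intro set_integral_eq_integral) blast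

  have int_grad: "integrable lborel (\<lambda>x. V (norm x) * norm (gradient u x) powr p)"
    using p grad0 continuous_on_abs_powr[OF _ continuous_on_norm[OF cont_grad], of p]
    by (intro int continuous_on_mult cont) auto
  have int_d: "integrable lborel (\<lambda>x. V (norm x) * \<bar>d x\<bar> powr p)"
    using p d0 by (intro int continuous_on_mult continuous_on_abs_powr cont) auto
  have int_\<rho>: "integrable lborel (\<lambda>x. \<bar>\<rho> (norm x)\<bar> powr p * V (norm x) * \<bar>u x\<bar> powr p)"
    using p u0 by (intro int continuous_on_mult continuous_on_abs_powr cont) auto
  have int_W: "integrable lborel (\<lambda>x. W (norm x) * \<bar>u x\<bar> powr p)"
    using p u0 by (intro int continuous_on_mult continuous_on_abs_powr cont) auto
  have f_powr: "(\<lambda>x. f x powr p) = (\<lambda>x. V (norm x) * \<bar>d x\<bar> powr p)"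
  proof
    fix x show "f x powr p = V (norm x) * \<bar>d x\<bar> powr p"
      using VC[of x] d0[of x] p by (cases "x \<in> C") (auto simp: f_def powr_mult powr_powr)
  qed
  have g_powr: "(\<lambda>x. g x powr p) = (\<lambda>x. \<bar>\<rho> (norm x)\<bar> powr p * V (norm x) * \<bar>u x\<bar> powr p)"
  proof
    fix x show "g x powr p = \<bar>\<rho> (norm x)\<bar> powr p * V (norm x) * \<bar>u x\<bar> powr p"
      using VC[of x] u0[of x] p by (cases "x \<in> C") (auto simp: g_def powr_mult powr_powr)
  qed
  define a where "a = (LINT x|lborel. V (norm x) * \<bar>d x\<bar> powr p)"
  define b where "b = (LINT x|lborel. \<bar>\<rho> (norm x)\<bar> powr p * V (norm x) * \<bar>u x\<bar> powr p)"
  have int_f: "integrable lborel (\<lambda>x. f x powr p)" and int_g: "integrable lborel (\<lambda>x. g x powr p)"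
    using int_d int_\<rho> by (simp_all add: f_powr g_powr)
  have a: "a = (LINT x|lborel. f x powr p)" and b: "b = (LINT x|lborel. g x powr p)"
    by (simp_all add: a_def b_def f_powr g_powr)
  have cont_V_powr: "continuous_on ?S (\<lambda>x. V (norm x) powr (1 / p))"
    using p V by (intro continuous_on_powr' cont continuous_on_const) auto
  have fg: "0 \<le> f x" "0 \<le> g x" for x by (simp_all add: f_def g_def)
  have "continuous_on ?S f" "continuous_on ?S g" unfolding f_def g_def
    by (intro continuous_on_mult cont_V_powr continuous_on_rabs cont)+
  then have int_fg: "integrable lborel (\<lambda>x. f x * g x powr (p - 1))"
    using p fg d0 by (intro int continuous_on_mult continuous_on_powr' continuous_on_const)
      (auto simp: f_def)

  define J where "J = (\<lambda>x. (W (norm x) + (p - 1) * \<bar>\<rho> (norm x)\<bar> powr p * V (norm x)) * \<bar>u x\<bar> powr p)"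
  have J: "J = (\<lambda>x. W (norm x) * \<bar>u x\<bar> powr p
      + (p - 1) * (\<bar>\<rho> (norm x)\<bar> powr p * V (norm x) * \<bar>u x\<bar> powr p))"
    by (simp add: J_def algebra_simps)
  have J_le: "integral\<^sup>L lborel J \<le> p * (LINT x|lborel. f x * g x powr (p - 1))"
  proof -
    define D where "D = (\<lambda>x. p * (V (norm x) * signed_powr (p - 1) (\<rho> (norm x))
      * signed_powr (p - 1) (u x) * d x) - J x)"
    have "has_bochner_integral lborel D 0"
      using integral_Riccati_weight[OF p cont_V cont_W sol u] by (simp add: D_def J_def d_def \<rho>_def)
    then have D: "integrable lborel D" "integral\<^sup>L lborel D = 0"
      by (simp_all add: has_bochner_integral_iff)
    have "J x + D x \<le> p * (f x * g x powr (p - 1))" for x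
    proof (cases "x \<in> C")
      case True
      then have V0: "0 \<le> V (norm x)" by (rule VC)
      \<comment> \<open>The weight is split by the exponents \<open>1/p\<close> and \<open>(p-1)/p\<close>.\<close>
      have "V (norm x) = V (norm x) powr (1 / p) * (V (norm x) powr (1 / p)) powr (p - 1)"
        using V0 p by (cases "V (norm x) = 0") (auto simp: powr_powr powr_add[symmetric] field_simps)
      then have fg_eq: "f x * g x powr (p - 1)
          = V (norm x) * (\<bar>\<rho> (norm x)\<bar> powr (p - 1) * \<bar>u x\<bar> powr (p - 1) * \<bar>d x\<bar>)"
        by (simp add: f_def g_def powr_mult)
      have "J x + D x = p * (V (norm x) * (signed_powr (p - 1) (\<rho> (norm x)) * signed_powr (p - 1) (u x) * d x))"
        by (simp add: D_def mult.assoc)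
      also have "\<dots> \<le> p * (V (norm x) * \<bar>signed_powr (p - 1) (\<rho> (norm x)) * signed_powr (p - 1) (u x) * d x\<bar>)"
        using V0 p by (intro mult_left_mono) auto
      also have "\<dots> = p * (f x * g x powr (p - 1))"
        by (simp add: fg_eq abs_mult abs_signed_powr)
      finally show ?thesis .
    next
      case False
      then show ?thesis by (simp add: D_def f_def d0)
    qed
    then have "(LINT x|lborel. J x + D x) \<le> (LINT x|lborel. p * (f x * g x powr (p - 1)))"
      using D int_W int_\<rho> int_fg by (intro integral_mono) (auto simp: J)
    moreover have "integrable lborel J" using int_W int_\<rho> by (simp add: J)
    ultimately show ?thesis using D by simp
  qed

  have nonneg: "0 \<le> a"
    unfolding a by (intro integral_nonneg_AE) auto
  have grad_le: "a \<le> (LINT x|lborel. V (norm x) * norm (gradient u x) powr p)"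
    unfolding a_def
  proof (intro integral_mono int_d int_grad)
    fix x show "V (norm x) * \<bar>d x\<bar> powr p \<le> V (norm x) * norm (gradient u x) powr p"
    proof (cases "x \<in> C")
      case True
      then have "x \<in> ?S" using C by blast
      then have "\<bar>d x\<bar> \<le> norm (gradient u x)"
        using Cauchy_Schwarz_ineq2[of "x /\<^sub>R norm x" "gradient u x"] by (simp add: d_def)
      then show ?thesis
        using V[OF \<open>x \<in> ?S\<close>] p by (intro mult_left_mono powr_mono2) auto
    qed (simp add: d0 grad0)
  qed
  have Hardy: "(LINT x|lborel. W (norm x) * \<bar>u x\<bar> powr p) \<le> a"
  proof -
    have "p * (f x * g x powr (p - 1)) \<le> f x powr p + (p - 1) * g x powr p" for x
      using mult_left_mono[OF Young_powr[OF p fg], of p x x] p by (simp add: distrib_left)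
    then have "(LINT x|lborel. p * (f x * g x powr (p - 1))) \<le> (LINT x|lborel. f x powr p + (p - 1) * g x powr p)"
      using int_fg int_f int_g by (intro integral_mono) auto
    also have "\<dots> = a + (p - 1) * b"
      using int_f int_g by (simp add: a b)
    finally have "p * (LINT x|lborel. f x * g x powr (p - 1)) \<le> a + (p - 1) * b"
      by simp
    moreover have "integral\<^sup>L lborel J = (LINT x|lborel. W (norm x) * \<bar>u x\<bar> powr p) + (p - 1) * b"
      using int_W int_\<rho> by (simp add: J b_def)
    ultimately show ?thesis using J_le by simp
  qed
  have CKN: "1 / p * integral\<^sup>L lborel J \<le> a powr (1 / p) * b powr ((p - 1) / p)"
  proof -
    have "1 / p * integral\<^sup>L lborel J \<le> (LINT x|lborel. f x * g x powr (p - 1))"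
      using J_le p by (simp add: field_simps)
    also have "\<dots> \<le> a powr (1 / p) * b powr ((p - 1) / p)"
      unfolding a b by (rule Holder_powr[OF p fg int_f int_g int_fg])
    finally show ?thesis .
  qed
  have eqs:
    "(LINT x:eball0 R|lborel. V (norm x) * norm (gradient u x) powr p)
      = (LINT x|lborel. V (norm x) * norm (gradient u x) powr p)"
    "(LINT x:eball0 R|lborel. V (norm x) * \<bar>(x /\<^sub>R norm x) \<bullet> gradient u x\<bar> powr p) = a"
    "(LINT x:eball0 R|lborel. W (norm x) * \<bar>u x\<bar> powr p) = (LINT x|lborel. W (norm x) * \<bar>u x\<bar> powr p)"
    "(LINT x:eball0 R|lborel. \<bar>deriv \<phi> (norm x) / \<phi> (norm x)\<bar> powr p * V (norm x) * \<bar>u x\<bar> powr p) = b"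
    "(LINT x:eball0 R|lborel. (W (norm x) + (p - 1) * \<bar>deriv \<phi> (norm x) / \<phi> (norm x)\<bar> powr p * V (norm x))
        * \<bar>u x\<bar> powr p) = integral\<^sup>L lborel J"
    unfolding a_def b_def J_def d_def \<rho>_def by (intro set_int; simp add: u0 grad0)+
  show "(LINT x:eball0 R|lborel. V (norm x) * norm (gradient u x) powr p)
        \<ge> (LINT x:eball0 R|lborel. V (norm x) * \<bar>(x /\<^sub>R norm x) \<bullet> gradient u x\<bar> powr p)
      \<and> (LINT x:eball0 R|lborel. V (norm x) * \<bar>(x /\<^sub>R norm x) \<bullet> gradient u x\<bar> powr p)
        \<ge> (LINT x:eball0 R|lborel. W (norm x) * \<bar>u x\<bar> powr p)
      \<and> (LINT x:eball0 R|lborel. V (norm x) * norm (gradient u x) powr p) powr (1 / p)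
          * (LINT x:eball0 R|lborel.
               \<bar>deriv \<phi> (norm x) / \<phi> (norm x)\<bar> powr p * V (norm x) * \<bar>u x\<bar> powr p) powr ((p - 1) / p)
        \<ge> (LINT x:eball0 R|lborel. V (norm x) * \<bar>(x /\<^sub>R norm x) \<bullet> gradient u x\<bar> powr p) powr (1 / p)
          * (LINT x:eball0 R|lborel.
               \<bar>deriv \<phi> (norm x) / \<phi> (norm x)\<bar> powr p * V (norm x) * \<bar>u x\<bar> powr p) powr ((p - 1) / p)
      \<and> (LINT x:eball0 R|lborel. V (norm x) * \<bar>(x /\<^sub>R norm x) \<bullet> gradient u x\<bar> powr p) powr (1 / p)
          * (LINT x:eball0 R|lborel.
               \<bar>deriv \<phi> (norm x) / \<phi> (norm x)\<bar> powr p * V (norm x) * \<bar>u x\<bar> powr p) powr ((p - 1) / p)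
        \<ge> 1 / p * (LINT x:eball0 R|lborel.
               (W (norm x) + (p - 1) * \<bar>deriv \<phi> (norm x) / \<phi> (norm x)\<bar> powr p * V (norm x))
               * \<bar>u x\<bar> powr p)"
    unfolding eqs
    using grad_le Hardy CKN nonneg p
    by (auto intro!: mult_right_mono powr_mono2)
qed

end
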